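(* Let $(w,w_0)$ be a weight function, $c$ a subterm coefficient function, $\succsim$ a quasi-precedence and $\sigma$ a status. If $w_0>0$ and $w$ is admissible for $\succsim$, then $\succ_{\mathrm{WPO}(\mathcal A_{\mathrm{pol}})}=\succ_{\mathrm{TKBO}}$, where $\mathcal A_{\mathrm{pol}}$ is the linear polynomial algebra induced by $(w,w_0)$ and $c$, and both orders use $\succsim$ and $\sigma$.
   Context: Terms over a finite signature $\Sigma$ and variables $\mathcal V$. A weight function $(w,w_0)$: $w:\Sigma\to\mathbb N$, $w_0\in\mathbb N$ with $w(c)\ge w_0$ for constants. A subterm coefficient function $c$ assigns a positive integer $c(f,i)$ to each $f\in\Sigma_n$ and $i\in\{1,\dots,n\}$. Refined weight: $w(x)=w_0$, $w(f(s_1,\dots,s_n))=w(f)+\sum_i c(f,i)\,w(s_i)$. Variable coefficient: $vc(x,x)=1$, $vc(x,y)=0$ for variables $y\ne x$, $vc(x,f(s_1,\dots,s_n))=\sum_i c(f,i)\,vc(x,s_i)$. $w$ is admissible for $\succsim$ iff every unary $f$ with $w(f)=0$ satisfies $f\succsim g$ for all $g$. A quasi-precedence is a quasi-order on $\Sigma$ with well-founded strict part $\succ$ and equivalence $\sim$. A status $\sigma$ maps $f\in\Sigma_n$ to a permutation $[i_1,\dots,i_n]$; $\sigma(f)(s_1..s_n)=[s_{i_1},\dots,s_{i_n}]$. For strict $\succ$ with reflexive closure $\succeq$: $[s_1..s_n]\succ^{\mathrm{lex}}[t_1..t_m]$ iff there is $k<n$ with $s_i\succeq t_i$ for $i\le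 k$ and either $k=m$, or $k<m$ and $s_{k+1}\succ t_{k+1}$. TKBO: $s=f(s_1..s_n)\succ_{\mathrm{TKBO}}t$ iff $vc(x,s)\ge vc(x,t)$ for all $x$ and either $w(s)>w(t)$, or $w(s)=w(t)$ and either (a) $t\in\mathcal V$ and $s=f^k(t)$ for some $k>0$, or (b) $t=g(t_1..t_m)$ and $f\succ g$, or $f\sim g$ and $\sigma(f)(s_1..s_n)\succ_{\mathrm{TKBO}}^{\mathrm{lex}}\sigma(g)(t_1..t_m)$ (refined weights). Variables are greater than nothing. $\mathcal A_{\mathrm{pol}}$: carrier $\{a\in\mathbb N\mid a\ge w_0\}$, usual $\ge,>$, $f_{\mathcal A}(a_1..a_n)=w(f)+\sum_i c(f,i)a_i$; $s\ge_{\mathcal A}t$ (resp. $>_{\mathcal A}$) iff $\hat\alpha(s)\ge\hat\alpha(t)$ (resp. $>$) for all assignments $\alpha$. WPO for an algebra $\mathcal A$: no variable is greater than any term; $s=f(s_1..s_n)\succ_{\mathrm{WPO}(\mathcal A)}t$ iff (1) $s>_{\mathcal A}t$, or (2) $s\ge_{\mathcal A}t$ and either (a) $s_i\succeq_{\mathrm{WPO}(\mathcal A)}t$ for some $i$, or (b) $t=g(t_1..t_m)$, $s\succ_{\mathrm{WPO}(\mathcal A)}t_j$ for all $j$, and $f\succ g$, or $f\sim g$ and $\sigma(f)(s_1..s_n)\succ_{\mathrm{WPO}(\mathcal A)}^{\mathrm{lex}}\sigma(g)(t_1..t_m)$.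
   Formalization: False as stated if two distinct unary symbols f∼g have weight 0 and coefficient 1 (f(g(x)) exceeds x in WPO, not in TKBO); proved with f^k in TKBO clause (a) read modulo ∼, and with literal f^k when at most one unary symbol has weight 0 and coefficient 1. *)

theory Defs
  imports Main
begin

datatype ('f, 'v) trm = Var 'v | Fun 'f "('f, 'v) trm list"

inductive_set terms :: "'f set \<Rightarrow> ('f \<Rightarrow> nat) \<Rightarrow> ('f, 'v) trm set"
  for F :: "'f set" and ar :: "'f \<Rightarrow> nat"
where
  "Var x \<in> terms F ar"
| "f \<in> F \<Longrightarrow> length ss = ar f \<Longrightarrow> (\<And>s. s \<in> set ss \<Longrightarrow> s \<in> terms F ar)
   \<Longrightarrow> Fun f ss \<in> terms F ar"

text \<open>Argument positions are counted from 0, so position \<open>i\<close> of an \<open>n\<close>-ary symbol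
  satisfies \<open>i < n\<close>.\<close>

definition weight_function :: "'f set \<Rightarrow> ('f \<Rightarrow> nat) \<Rightarrow> ('f \<Rightarrow> nat) \<Rightarrow> nat \<Rightarrow> bool" where
  "weight_function F ar w w0 \<longleftrightarrow> (\<forall>f\<in>F. ar f = 0 \<longrightarrow> w f \<ge> w0)"

definition subterm_coefficient :: "'f set \<Rightarrow> ('f \<Rightarrow> nat) \<Rightarrow> ('f \<Rightarrow> nat \<Rightarrow> nat) \<Rightarrow> bool" where
  "subterm_coefficient F ar c \<longleftrightarrow> (\<forall>f\<in>F. \<forall>i<ar f. c f i > 0)"

definition strict_part :: "('f \<Rightarrow> 'f \<Rightarrow> bool) \<Rightarrow> 'f \<Rightarrow> 'f \<Rightarrow> bool" where
  "strict_part ge f g \<longleftrightarrow> ge f g \<and> \<not> ge g f"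

definition equiv_part :: "('f \<Rightarrow> 'f \<Rightarrow> bool) \<Rightarrow> 'f \<Rightarrow> 'f \<Rightarrow> bool" where
  "equiv_part ge f g \<longleftrightarrow> ge f g \<and> ge g f"

definition quasi_precedence :: "'f set \<Rightarrow> ('f \<Rightarrow> 'f \<Rightarrow> bool) \<Rightarrow> bool" where
  "quasi_precedence F ge \<longleftrightarrow>
     reflp_on F ge \<and> transp_on F ge \<and> wfp_on F (\<lambda>g f. strict_part ge f g)"

definition is_status :: "'f set \<Rightarrow> ('f \<Rightarrow> nat) \<Rightarrow> ('f \<Rightarrow> nat list) \<Rightarrow> bool" where
  "is_status F ar \<sigma> \<longleftrightarrow> (\<forall>f\<in>F. distinct (\<sigma> f) \<and> set (\<sigma> f) = {..<ar f})"

definition arrange :: "('f \<Rightarrow> nat list) \<Rightarrow> 'f \<Rightarrow> 'a list \<Rightarrow> 'a list" where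
  "arrange \<sigma> f ss = map (\<lambda>i. ss ! i) (\<sigma> f)"

definition admissible ::
  "'f set \<Rightarrow> ('f \<Rightarrow> nat) \<Rightarrow> ('f \<Rightarrow> nat) \<Rightarrow> ('f \<Rightarrow> 'f \<Rightarrow> bool) \<Rightarrow> bool" where
  "admissible F ar w ge \<longleftrightarrow> (\<forall>f\<in>F. ar f = 1 \<and> w f = 0 \<longrightarrow> (\<forall>g\<in>F. ge f g))"

lemma size_nth_trm [termination_simp]:
  "i < length ss \<Longrightarrow> size (ss ! i) < Suc (size_list size ss)"
  by (meson le_imp_less_Suc nth_mem order_refl size_list_estimation')

fun weight :: "('f \<Rightarrow> nat) \<Rightarrow> nat \<Rightarrow> ('f \<Rightarrow> nat \<Rightarrow> nat) \<Rightarrow> ('f, 'v) trm \<Rightarrow> nat" where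
  "weight w w0 c (Var x) = w0"
| "weight w w0 c (Fun f ss) = w f + (\<Sum>i<length ss. c f i * weight w w0 c (ss ! i))"

fun vc :: "('f \<Rightarrow> nat \<Rightarrow> nat) \<Rightarrow> 'v \<Rightarrow> ('f, 'v) trm \<Rightarrow> nat" where
  "vc c x (Var y) = (if y = x then 1 else 0)"
| "vc c x (Fun f ss) = (\<Sum>i<length ss. c f i * vc c x (ss ! i))"

definition lex_gt :: "('a \<Rightarrow> 'a \<Rightarrow> bool) \<Rightarrow> 'a list \<Rightarrow> 'a list \<Rightarrow> bool" where
  "lex_gt gt ss ts \<longleftrightarrow>
     (\<exists>k<length ss. k \<le> length ts \<and> (\<forall>i<k. gt\<^sup>=\<^sup>= (ss ! i) (ts ! i)) \<and>
        (k = length ts \<or> k < length ts \<and> gt (ss ! k) (ts ! k)))"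

lemma lex_gt_mono [mono]: "P \<le> Q \<Longrightarrow> lex_gt P ss ts \<longrightarrow> lex_gt Q ss ts"
  unfolding lex_gt_def by blast

text \<open>The order is parameterised by the predicate \<open>pw\<close> used in the clause for \<open>t = x\<close>, which is
  written \<open>s = f\<^sup>k(x)\<close>, \<open>k > 0\<close>. Two readings are instantiated below.\<close>

inductive tkbo_gen ::
  "('f \<Rightarrow> ('f, 'v) trm \<Rightarrow> 'v \<Rightarrow> bool) \<Rightarrow> 'f set \<Rightarrow> ('f \<Rightarrow> nat) \<Rightarrow> ('f \<Rightarrow> nat) \<Rightarrow> nat \<Rightarrow>
   ('f \<Rightarrow> nat \<Rightarrow> nat) \<Rightarrow> ('f \<Rightarrow> 'f \<Rightarrow> bool) \<Rightarrow> ('f \<Rightarrow> nat list) \<Rightarrow>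
   ('f, 'v) trm \<Rightarrow> ('f, 'v) trm \<Rightarrow> bool"
  for pw :: "'f \<Rightarrow> ('f, 'v) trm \<Rightarrow> 'v \<Rightarrow> bool" and F :: "'f set" and ar :: "'f \<Rightarrow> nat"
    and w :: "'f \<Rightarrow> nat" and w0 :: nat and c :: "'f \<Rightarrow> nat \<Rightarrow> nat"
    and ge :: "'f \<Rightarrow> 'f \<Rightarrow> bool" and \<sigma> :: "'f \<Rightarrow> nat list"
where
  weight:
    "s = Fun f ss \<Longrightarrow> s \<in> terms F ar \<Longrightarrow> t \<in> terms F ar \<Longrightarrow> \<forall>x. vc c x s \<ge> vc c x t \<Longrightarrow>
     weight w w0 c s > weight w w0 c t \<Longrightarrow>
     tkbo_gen pw F ar w w0 c ge \<sigma> s t"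
| var:
    "s = Fun f ss \<Longrightarrow> s \<in> terms F ar \<Longrightarrow> t \<in> terms F ar \<Longrightarrow> \<forall>x. vc c x s \<ge> vc c x t \<Longrightarrow>
     weight w w0 c s = weight w w0 c t \<Longrightarrow>
     t = Var y \<Longrightarrow> pw f s y \<Longrightarrow>
     tkbo_gen pw F ar w w0 c ge \<sigma> s t"
| func:
    "s = Fun f ss \<Longrightarrow> s \<in> terms F ar \<Longrightarrow> t \<in> terms F ar \<Longrightarrow> \<forall>x. vc c x s \<ge> vc c x t \<Longrightarrow>
     weight w w0 c s = weight w w0 c t \<Longrightarrow>
     t = Fun g ts \<Longrightarrow>
     strict_part ge f g \<or>
     equiv_part ge f g \<and>
       lex_gt (tkbo_gen pw F ar w w0 c ge \<sigma>) (arrange \<sigma> f ss) (arrange \<sigma> g ts) \<Longrightarrow>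
     tkbo_gen pw F ar w w0 c ge \<sigma> s t"

definition fun_power :: "'f \<Rightarrow> ('f, 'v) trm \<Rightarrow> 'v \<Rightarrow> bool" where
  "fun_power f s x \<longleftrightarrow> (\<exists>k>0. s = ((\<lambda>u. Fun f [u]) ^^ k) (Var x))"

abbreviation "tkbo \<equiv> tkbo_gen fun_power"

text \<open>The power modulo the equivalence of the quasi-precedence: \<open>f\<^sub>1(\<dots>f\<^sub>k(x)\<dots>)\<close> with \<open>k > 0\<close>
  and all \<open>f\<^sub>i\<close> equivalent to \<open>f\<close>. For an antisymmetric precedence this is \<open>fun_power\<close>.
  A proper quasi-precedence may have two distinct greatest unary symbols \<open>f\<close>, \<open>g\<close> of
  weight 0 and coefficient 1; then \<open>f(g(x))\<close> and \<open>x\<close> are related by \<open>wpo\<close> but not by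
  \<open>tkbo\<close>, see \<open>wpo_neq_tkbo\<close>.\<close>

definition fun_power_mod :: "('f \<Rightarrow> 'f \<Rightarrow> bool) \<Rightarrow> 'f \<Rightarrow> ('f, 'v) trm \<Rightarrow> 'v \<Rightarrow> bool" where
  "fun_power_mod ge f s x \<longleftrightarrow>
     (\<exists>fs. fs \<noteq> [] \<and> (\<forall>g\<in>set fs. equiv_part ge f g) \<and>
        s = foldr (\<lambda>g u. Fun g [u]) fs (Var x))"

abbreviation "tkbo_mod F ar w w0 c ge \<equiv> tkbo_gen (fun_power_mod ge) F ar w w0 c ge"

record ('f, 'a) algebra =
  carrier :: "'a set"
  interp :: "'f \<Rightarrow> 'a list \<Rightarrow> 'a"
  geq :: "'a \<Rightarrow> 'a \<Rightarrow> bool"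
  gt :: "'a \<Rightarrow> 'a \<Rightarrow> bool"

fun eval :: "('f, 'a) algebra \<Rightarrow> ('v \<Rightarrow> 'a) \<Rightarrow> ('f, 'v) trm \<Rightarrow> 'a" where
  "eval A \<alpha> (Var x) = \<alpha> x"
| "eval A \<alpha> (Fun f ss) = interp A f (map (eval A \<alpha>) ss)"

definition alg_geq :: "('f, 'a) algebra \<Rightarrow> ('f, 'v) trm \<Rightarrow> ('f, 'v) trm \<Rightarrow> bool" where
  "alg_geq A s t \<longleftrightarrow>
     (\<forall>\<alpha>. (\<forall>x. \<alpha> x \<in> carrier A) \<longrightarrow> geq A (eval A \<alpha> s) (eval A \<alpha> t))"

definition alg_gt :: "('f, 'a) algebra \<Rightarrow> ('f, 'v) trm \<Rightarrow> ('f, 'v) trm \<Rightarrow> bool" where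
  "alg_gt A s t \<longleftrightarrow>
     (\<forall>\<alpha>. (\<forall>x. \<alpha> x \<in> carrier A) \<longrightarrow> gt A (eval A \<alpha> s) (eval A \<alpha> t))"

definition A_pol :: "('f \<Rightarrow> nat) \<Rightarrow> nat \<Rightarrow> ('f \<Rightarrow> nat \<Rightarrow> nat) \<Rightarrow> ('f, nat) algebra" where
  "A_pol w w0 c =
     \<lparr> carrier = {a. a \<ge> w0},
       interp = (\<lambda>f as. w f + (\<Sum>i<length as. c f i * as ! i)),
       geq = (\<ge>),
       gt = (>) \<rparr>"

inductive wpo ::
  "'f set \<Rightarrow> ('f \<Rightarrow> nat) \<Rightarrow> ('f, 'a) algebra \<Rightarrow> ('f \<Rightarrow> 'f \<Rightarrow> bool) \<Rightarrow> ('f \<Rightarrow> nat list) \<Rightarrow>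
   ('f, 'v) trm \<Rightarrow> ('f, 'v) trm \<Rightarrow> bool"
  for F :: "'f set" and ar :: "'f \<Rightarrow> nat" and A :: "('f, 'a) algebra"
    and ge :: "'f \<Rightarrow> 'f \<Rightarrow> bool" and \<sigma> :: "'f \<Rightarrow> nat list"
where
  alg:
    "s = Fun f ss \<Longrightarrow> s \<in> terms F ar \<Longrightarrow> t \<in> terms F ar \<Longrightarrow>
     alg_gt A s t \<Longrightarrow>
     wpo F ar A ge \<sigma> s t"
| arg:
    "s = Fun f ss \<Longrightarrow> s \<in> terms F ar \<Longrightarrow> t \<in> terms F ar \<Longrightarrow>
     alg_geq A s t \<Longrightarrow>
     \<exists>s'\<in>set ss. wpo F ar A ge \<sigma> s' t \<or> s' = t \<Longrightarrow>
     wpo F ar A ge \<sigma> s t"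
| func:
    "s = Fun f ss \<Longrightarrow> s \<in> terms F ar \<Longrightarrow> t \<in> terms F ar \<Longrightarrow>
     alg_geq A s t \<Longrightarrow>
     t = Fun g ts \<Longrightarrow> \<forall>t'\<in>set ts. wpo F ar A ge \<sigma> s t' \<Longrightarrow>
     strict_part ge f g \<or>
     equiv_part ge f g \<and>
       lex_gt (wpo F ar A ge \<sigma>) (arrange \<sigma> f ss) (arrange \<sigma> g ts) \<Longrightarrow>
     wpo F ar A ge \<sigma> s t"

lemma wpo_neq_tkbo:
  fixes x :: 'v
  assumes F: "f \<in> F" "g \<in> F" and ar: "ar f = 1" "ar g = 1" and w: "w f = 0" "w g = 0"
    and c: "c f 0 = 1" "c g 0 = 1" and neq: "f \<noteq> g"
  shows "wpo F ar (A_pol w w0 c) ge \<sigma> (Fun f [Fun g [Var x]]) (Var x)"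
    and "\<not> tkbo F ar w w0 c ge \<sigma> (Fun f [Fun g [Var x]]) (Var x)"
proof -
  have g: "Fun g [Var x] \<in> terms F ar"
    using F ar by (auto intro!: terms.intros)
  have fg: "Fun f [Fun g [Var x]] \<in> terms F ar"
    using F ar g by (auto intro!: terms.intros)
  have "wpo F ar (A_pol w w0 c) ge \<sigma> (Fun g [Var x]) (Var x)"
    by (rule wpo.arg[OF refl g terms.intros(1)])
      (use w c in \<open>auto simp: alg_geq_def A_pol_def\<close>)
  then show "wpo F ar (A_pol w w0 c) ge \<sigma> (Fun f [Fun g [Var x]]) (Var x)"
    by (intro wpo.arg[OF refl fg terms.intros(1)])
      (use w c in \<open>auto simp: alg_geq_def A_pol_def\<close>)
  have "\<not> fun_power f (Fun f [Fun g [Var x]]) x"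
  proof
    assume "fun_power f (Fun f [Fun g [Var x]]) x"
    then obtain k where k: "k > 0" "Fun f [Fun g [Var x]] = ((\<lambda>u. Fun f [u]) ^^ k) (Var x)"
      unfolding fun_power_def by blast
    then obtain j where "k = Suc j" by (cases k) auto
    then show False using k neq by (cases j) auto
  qed
  then show "\<not> tkbo F ar w w0 c ge \<sigma> (Fun f [Fun g [Var x]]) (Var x)"
    using w c by (auto elim!: tkbo_gen.cases)
qed

end

theory Submission
  imports Defs
begin

text \<open>Evaluation in the linear polynomial algebra is affine in the assignment, with coefficients
  \<open>vc\<close> and value \<open>weight\<close> at the constant assignment \<open>w\<^sub>0\<close>; so comparing two terms in the
  algebra amounts to comparing variable coefficients and weights. As \<open>w\<^sub>0 > 0\<close>, a term can have the
  same weight as one of its arguments only if its root is unary of weight 0 and coefficient 1,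
  hence greatest in the precedence by admissibility. This makes the subterm clause of WPO
  an instance of a TKBO clause, and makes the condition \<open>s \<succ> t\<^sub>j\<close> of WPO automatic in TKBO.\<close>

section \<open>Comparisons in the linear polynomial algebra\<close>

lemma interp_A_pol_map [simp]:
  "interp (A_pol w w0 c) f (map h ss) = w f + (\<Sum>i<length ss. c f i * h (ss ! i))"
  by (simp add: A_pol_def)

lemma eval_A_pol_const [simp]: "eval (A_pol w w0 c) (\<lambda>_. w0) s = weight w w0 c s"
  by (induction s) simp_all

text \<open>By linearity \<open>vc c x s\<close> is the slope of the evaluation in \<open>x\<close>;
  raising one variable is the probe that recovers it from the algebra.\<close>

lemma eval_A_pol_fun_upd_add:
  "eval (A_pol w w0 c) (\<alpha>(x := \<alpha> x + d)) s = eval (A_pol w w0 c) \<alpha> s + d * vc c x s"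
proof (induction s)
  case (Fun f ss)
  have "(\<Sum>i<length ss. c f i * eval (A_pol w w0 c) (\<alpha>(x := \<alpha> x + d)) (ss ! i)) =
      (\<Sum>i<length ss. c f i * eval (A_pol w w0 c) \<alpha> (ss ! i) + d * (c f i * vc c x (ss ! i)))"
  proof (rule sum.cong)
    fix i assume "i \<in> {..<length ss}"
    then have "ss ! i \<in> set ss" by simp
    from Fun.IH[OF this]
    show "c f i * eval (A_pol w w0 c) (\<alpha>(x := \<alpha> x + d)) (ss ! i) =
        c f i * eval (A_pol w w0 c) \<alpha> (ss ! i) + d * (c f i * vc c x (ss ! i))"
      by (simp only: distrib_left mult.left_commute)
  qed simp
  then show ?case by (simp add: sum.distrib sum_distrib_left del: fun_upd_apply)
qed auto

lemma finite_set2_trm [simp]: "finite (set2_trm s)"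
  by (induction s) auto

text \<open>The set \<open>V\<close> may exceed the variables of \<open>s\<close>, so that two terms
  can be expanded over a common set. The lower bound on \<alpha> makes the truncated subtraction
  exact.\<close>

lemma eval_A_pol_affine:
  assumes "finite V" "set2_trm s \<subseteq> V" "\<And>x. w0 \<le> \<alpha> x"
  shows "eval (A_pol w w0 c) \<alpha> s = weight w w0 c s + (\<Sum>x\<in>V. (\<alpha> x - w0) * vc c x s)"
  using assms(2)
proof (induction s)
  case (Var y)
  then show ?case using assms(1,3) by (simp add: if_distrib cong: if_cong)
next
  case (Fun f ss)
  let ?S = "\<lambda>s. \<Sum>x\<in>V. (\<alpha> x - w0) * vc c x s"
  have "eval (A_pol w w0 c) \<alpha> (ss ! i) = weight w w0 c (ss ! i) + ?S (ss ! i)"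
    if "i < length ss" for i
    using Fun that by (auto simp: UN_subset_iff)
  then have "(\<Sum>i<length ss. c f i * eval (A_pol w w0 c) \<alpha> (ss ! i)) =
      (\<Sum>i<length ss. c f i * weight w w0 c (ss ! i)) + (\<Sum>i<length ss. c f i * ?S (ss ! i))"
    by (simp add: algebra_simps sum.distrib)
  moreover have "(\<Sum>i<length ss. c f i * ?S (ss ! i)) = ?S (Fun f ss)"
    by (simp add: sum_distrib_left sum.swap[of _ V] mult.left_commute)
  ultimately show ?case by simp
qed

lemma alg_geq_A_pol_imp_vc_ge:
  assumes "alg_geq (A_pol w w0 c) s t"
  shows "vc c x s \<ge> vc c x t"
proof (rule ccontr)
  assume "\<not> vc c x s \<ge> vc c x t"
  then have lt: "Suc (vc c x s) \<le> vc c x t" by simp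
  \<comment> \<open>A deficit of one in the coefficient of \<open>x\<close> costs \<open>s\<close>
    at least \<open>d\<close>, which its weight cannot make up.\<close>
  define d where "d = Suc (weight w w0 c s)"
  define \<alpha> where "\<alpha> = (\<lambda>_. w0)(x := w0 + d)"
  have ev: "eval (A_pol w w0 c) \<alpha> u = weight w w0 c u + d * vc c x u" for u
    unfolding \<alpha>_def using eval_A_pol_fun_upd_add[of w w0 c "\<lambda>_. w0" x d u] by simp
  have "\<forall>x. \<alpha> x \<in> carrier (A_pol w w0 c)" by (simp add: \<alpha>_def A_pol_def)
  then have "geq (A_pol w w0 c) (eval (A_pol w w0 c) \<alpha> s) (eval (A_pol w w0 c) \<alpha> t)"
    using assms by (simp add: alg_geq_def)
  then have "weight w w0 c s + d * vc c x s \<ge> d * vc c x t"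
    unfolding ev by (simp add: A_pol_def)
  moreover have "d * Suc (vc c x s) \<le> d * vc c x t" using lt by (rule mult_left_mono) simp
  ultimately show False by (simp add: d_def)
qed

lemma alg_geq_A_pol_imp_weight_ge:
  assumes "alg_geq (A_pol w w0 c) s t"
  shows "weight w w0 c s \<ge> weight w w0 c t"
proof -
  have "geq (A_pol w w0 c) (eval (A_pol w w0 c) (\<lambda>_. w0) s) (eval (A_pol w w0 c) (\<lambda>_. w0) t)"
    using assms unfolding alg_geq_def by (simp add: A_pol_def)
  then show ?thesis unfolding eval_A_pol_const by (simp add: A_pol_def)
qed

lemma alg_gt_A_pol_imp_weight_gt:
  assumes "alg_gt (A_pol w w0 c) s t"
  shows "weight w w0 c s > weight w w0 c t"
proof -
  have "gt (A_pol w w0 c) (eval (A_pol w w0 c) (\<lambda>_. w0) s) (eval (A_pol w w0 c) (\<lambda>_. w0) t)"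
    using assms unfolding alg_gt_def by (simp add: A_pol_def)
  then show ?thesis unfolding eval_A_pol_const by (simp add: A_pol_def)
qed

lemma alg_gt_A_pol_imp_alg_geq: "alg_gt (A_pol w w0 c) s t \<Longrightarrow> alg_geq (A_pol w w0 c) s t"
  unfolding alg_gt_def alg_geq_def by (auto simp: A_pol_def intro: less_imp_le)

text \<open>Over the union of both variable sets, domination of coefficients orders the variable
  contributions, leaving only the weights to be compared.\<close>

lemma eval_A_pol_affine_pair:
  assumes "\<And>x. w0 \<le> \<alpha> x" "\<And>x. vc c x s \<ge> vc c x t"
  obtains a b where "a \<ge> b" "eval (A_pol w w0 c) \<alpha> s = weight w w0 c s + a"
    "eval (A_pol w w0 c) \<alpha> t = weight w w0 c t + b"
proof -
  let ?V = "set2_trm s \<union> set2_trm t"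
  show thesis
  proof (rule that)
    show "(\<Sum>x\<in>?V. (\<alpha> x - w0) * vc c x s) \<ge> (\<Sum>x\<in>?V. (\<alpha> x - w0) * vc c x t)"
      using assms(2) by (intro sum_mono mult_left_mono) auto
  qed (use assms(1) in \<open>auto intro!: eval_A_pol_affine\<close>)
qed

lemma alg_geq_A_pol_iff:
  fixes s t :: "('f, 'v) trm"
  shows
  "alg_geq (A_pol w w0 c) s t \<longleftrightarrow>
     (\<forall>x. vc c x s \<ge> vc c x t) \<and> weight w w0 c s \<ge> weight w w0 c t" (is "_ \<longleftrightarrow> ?R")
proof
  assume R: ?R
  show "alg_geq (A_pol w w0 c) s t"
    unfolding alg_geq_def
  proof (intro allI impI)
    fix \<alpha> :: "'v \<Rightarrow> nat" assume "\<forall>x. \<alpha> x \<in> carrier (A_pol w w0 c)"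
    then have "\<And>x. w0 \<le> \<alpha> x" by (simp add: A_pol_def)
    then obtain a b where "a \<ge> b" "eval (A_pol w w0 c) \<alpha> s = weight w w0 c s + a"
      "eval (A_pol w w0 c) \<alpha> t = weight w w0 c t + b"
      using eval_A_pol_affine_pair R by metis
    then show "geq (A_pol w w0 c) (eval (A_pol w w0 c) \<alpha> s) (eval (A_pol w w0 c) \<alpha> t)"
      using R by (simp add: A_pol_def)
  qed
qed (auto dest: alg_geq_A_pol_imp_vc_ge alg_geq_A_pol_imp_weight_ge)

lemma alg_gt_A_pol_iff:
  fixes s t :: "('f, 'v) trm"
  shows
  "alg_gt (A_pol w w0 c) s t \<longleftrightarrow>
     (\<forall>x. vc c x s \<ge> vc c x t) \<and> weight w w0 c s > weight w w0 c t" (is "_ \<longleftrightarrow> ?R")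
proof
  assume R: ?R
  show "alg_gt (A_pol w w0 c) s t"
    unfolding alg_gt_def
  proof (intro allI impI)
    fix \<alpha> :: "'v \<Rightarrow> nat" assume "\<forall>x. \<alpha> x \<in> carrier (A_pol w w0 c)"
    then have "\<And>x. w0 \<le> \<alpha> x" by (simp add: A_pol_def)
    then obtain a b where "a \<ge> b" "eval (A_pol w w0 c) \<alpha> s = weight w w0 c s + a"
      "eval (A_pol w w0 c) \<alpha> t = weight w w0 c t + b"
      using eval_A_pol_affine_pair R by metis
    then show "gt (A_pol w w0 c) (eval (A_pol w w0 c) \<alpha> s) (eval (A_pol w w0 c) \<alpha> t)"
      using R by (simp add: A_pol_def)
  qed
qed (auto dest: alg_gt_A_pol_imp_weight_gt alg_gt_A_pol_imp_alg_geq alg_geq_A_pol_imp_vc_ge)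

section \<open>Lexicographic comparison, well-formed terms and general facts on both orders\<close>

lemma lex_gt_mono_on_set:
  assumes "lex_gt P ss ts" and PQ: "\<And>s t. s \<in> set ss \<Longrightarrow> P s t \<Longrightarrow> Q s t"
  shows "lex_gt Q ss ts"
proof -
  obtain k where k: "k < length ss" "k \<le> length ts" "\<forall>i<k. P\<^sup>=\<^sup>= (ss ! i) (ts ! i)"
    "k = length ts \<or> k < length ts \<and> P (ss ! k) (ts ! k)"
    using assms(1) unfolding lex_gt_def by blast
  have "Q\<^sup>=\<^sup>= (ss ! i) (ts ! i)" if "i < k" for i
    using k(1,3) that PQ[of "ss ! i" "ts ! i"] by auto
  moreover have "k = length ts \<or> k < length ts \<and> Q (ss ! k) (ts ! k)"
    using k(1,4) PQ[of "ss ! k" "ts ! k"] by auto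
  ultimately show ?thesis unfolding lex_gt_def using k(1,2) by blast
qed

lemma terms_FunD:
  assumes "Fun f ss \<in> terms F ar"
  shows "f \<in> F" "length ss = ar f" "\<And>s. s \<in> set ss \<Longrightarrow> s \<in> terms F ar"
  using assms by (auto elim: terms.cases)

lemma wpo_argI:
  assumes "Fun f ss \<in> terms F ar" "t \<in> terms F ar" "alg_geq A (Fun f ss) t"
    "s' \<in> set ss" "wpo F ar A ge \<sigma> s' t \<or> s' = t"
  shows "wpo F ar A ge \<sigma> (Fun f ss) t"
  using wpo.arg[OF refl assms(1-3)] assms(4,5) by blast

lemma wpo_A_pol_imp_alg_geq:
  "wpo F ar (A_pol w w0 c) ge \<sigma> s t \<Longrightarrow> alg_geq (A_pol w w0 c) s t"
  by (auto elim!: wpo.cases intro: alg_gt_A_pol_imp_alg_geq)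

text \<open>The variable clause compares terms of equal weight, so the power predicates matter only
  on terms of weight \<open>w0\<close>. This bound is what later forces every symbol of the power to
  be collapsing.\<close>

lemma tkbo_gen_mono:
  assumes "\<And>f ss y. Fun f ss \<in> terms F ar \<Longrightarrow> weight w w0 c (Fun f ss) = w0 \<Longrightarrow>
      pw f (Fun f ss) y \<Longrightarrow> pw' f (Fun f ss) y"
  shows "tkbo_gen pw F ar w w0 c ge \<sigma> s t \<Longrightarrow> tkbo_gen pw' F ar w w0 c ge \<sigma> s t"
proof (induction rule: tkbo_gen.induct)
  case (weight s f ss t)
  then show ?case by (rule tkbo_gen.weight)
next
  case (var s f ss t y)
  show ?case
    by (rule tkbo_gen.var[OF var(1-6)]) (use assms var in auto)
next
  case (func s f ss t g ts)
  show ?case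
    by (rule tkbo_gen.func[OF func(1-6)]) (use func(7) in \<open>auto simp: lex_gt_def\<close>)
qed

section \<open>Weights, collapsing symbols and status under the standing assumptions\<close>

locale weighted_precedence =
  fixes F :: "'f set" and ar :: "'f \<Rightarrow> nat" and w :: "'f \<Rightarrow> nat" and w0 :: nat
    and c :: "'f \<Rightarrow> nat \<Rightarrow> nat" and ge :: "'f \<Rightarrow> 'f \<Rightarrow> bool" and \<sigma> :: "'f \<Rightarrow> nat list"
  assumes weight_function: "weight_function F ar w w0"
    and coefficient: "subterm_coefficient F ar c"
    and precedence: "quasi_precedence F ge"
    and status: "is_status F ar \<sigma>"
    and w0_pos: "w0 > 0"
    and adm: "admissible F ar w ge"
begin

abbreviation "wt \<equiv> weight w w0 c"
abbreviation "A \<equiv> A_pol w w0 c"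
abbreviation "wpo_pol \<equiv> wpo F ar A ge \<sigma>"
abbreviation "tkbo_m \<equiv> tkbo_mod F ar w w0 c ge \<sigma>"

lemma coefficient_pos: "Fun f ss \<in> terms F ar \<Longrightarrow> i < length ss \<Longrightarrow> c f i > 0"
  using coefficient terms_FunD(1,2)[of f ss F ar] by (simp add: subterm_coefficient_def)

text \<open>The coefficient at \<open>i\<close> is at least 1 and the other summands are
  nonnegative. The function \<open>h\<close> stays abstract because it is instantiated both with
  weights and with variable coefficients.\<close>

lemma sum_args_ge:
  fixes h :: "nat \<Rightarrow> nat"
  assumes "Fun f ss \<in> terms F ar" "i < length ss"
  shows "h i \<le> (\<Sum>j<length ss. c f j * h j)"
proof -
  have "h i \<le> c f i * h i" using coefficient_pos[OF assms] by simp
  also have "\<dots> \<le> (\<Sum>j<length ss. c f j * h j)"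
    using assms(2) by (intro member_le_sum) auto
  finally show ?thesis .
qed

lemma weight_ge_w0: "s \<in> terms F ar \<Longrightarrow> wt s \<ge> w0"
proof (induction rule: terms.induct)
  case (2 f ss)
  show ?case
  proof (cases "ar f = 0")
    case True
    then show ?thesis using 2 weight_function by (auto simp: weight_function_def)
  next
    case False
    then have l: "0 < length ss" using 2 by simp
    have "Fun f ss \<in> terms F ar" using 2 by (auto intro: terms.intros)
    have "w0 \<le> wt (ss ! 0)" using 2 l by simp
    also have "\<dots> \<le> wt (Fun f ss)"
      using sum_args_ge[OF \<open>Fun f ss \<in> terms F ar\<close> l, of "\<lambda>i. wt (ss ! i)"] by simp
    finally show ?thesis .
  qed
qed simp

text \<open>Weak simplicity of the algebra, due to the positive coefficients.\<close>

lemma alg_geq_arg: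
  assumes "Fun f ss \<in> terms F ar" "s \<in> set ss"
  shows "alg_geq A (Fun f ss) s"
proof -
  obtain i where i: "i < length ss" "s = ss ! i" using assms(2) by (auto simp: in_set_conv_nth)
  show ?thesis unfolding alg_geq_A_pol_iff
    using sum_args_ge[OF assms(1) i(1), of "\<lambda>i. wt (ss ! i)"]
      sum_args_ge[OF assms(1) i(1), of "\<lambda>i. vc c _ (ss ! i)"] by (simp add: i(2) trans_le_add2)
qed

text \<open>The summand \<open>c f i * wt s\<close> alone reaches \<open>wt s\<close>, so
  \<open>w f\<close> and all other summands vanish. Weights and coefficients are positive, hence
  there is no other argument, and cancelling \<open>wt s\<close> leaves coefficient 1.\<close>

lemma weight_le_arg_imp_collapsing:
  assumes "Fun f ss \<in> terms F ar" "s \<in> set ss" "wt (Fun f ss) \<le> wt s"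
  shows "ss = [s]" "ar f = 1" "w f = 0" "c f 0 = 1"
proof -
  obtain i where i: "i < length ss" "s = ss ! i" using assms(2) by (auto simp: in_set_conv_nth)
  let ?S = "\<Sum>j\<in>{..<length ss} - {i}. c f j * wt (ss ! j)"
  have wt_pos: "wt (ss ! j) > 0" if "j < length ss" for j
    using weight_ge_w0[of "ss ! j"] w0_pos terms_FunD(3)[OF assms(1)] that by fastforce
  have "wt (Fun f ss) = w f + (c f i * wt s + ?S)"
    using i by (simp add: sum.remove[of "{..<length ss}" i])
  moreover have "c f i * wt s \<ge> wt s" using coefficient_pos[OF assms(1) i(1)] by simp
  ultimately have eq: "w f = 0" "?S = 0" "c f i * wt s = wt s" using assms(3) by linarith+
  have all_i: "j = i" if "j < length ss" for j
  proof (rule ccontr)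
    assume "j \<noteq> i"
    then have "c f j * wt (ss ! j) = 0"
      using eq(2) that by (simp only: sum_eq_0_iff finite_Diff finite_lessThan) simp
    then show False using coefficient_pos[OF assms(1) that] wt_pos[OF that] by simp
  qed
  have "i = 0" using all_i[of 0] i(1) by linarith
  moreover have "length ss = 1" using all_i[of 1] i(1) \<open>i = 0\<close> by linarith
  ultimately show "ss = [s]" "ar f = 1" "w f = 0" "c f 0 = 1"
    using eq i wt_pos[of i] terms_FunD(2)[OF assms(1)] by (auto simp: length_Suc_conv)
qed

lemma collapsing_greatest:
  "f \<in> F \<Longrightarrow> ar f = 1 \<Longrightarrow> w f = 0 \<Longrightarrow> g \<in> F \<Longrightarrow> ge f g"
  using adm by (auto simp: admissible_def)

text \<open>The inner term already weighs at least \<open>w0\<close>, so the outermost symbol adds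
  nothing and is collapsing. It then preserves the weight, and the bound passes to the inner
  term.\<close>

lemma foldr_collapsing:
  assumes "foldr (\<lambda>g u. Fun g [u]) fs (Var y) \<in> terms F ar"
    "wt (foldr (\<lambda>g u. Fun g [u]) fs (Var y)) \<le> w0" "g \<in> set fs"
  shows "g \<in> F" "ar g = 1" "w g = 0" "c g 0 = 1"
proof -
  have "g \<in> F \<and> ar g = 1 \<and> w g = 0 \<and> c g 0 = 1" using assms
  proof (induction fs)
    case (Cons h fs)
    let ?u = "foldr (\<lambda>g u. Fun g [u]) fs (Var y)"
    have t: "Fun h [?u] \<in> terms F ar" using Cons.prems by simp
    then have u: "?u \<in> terms F ar" by (rule terms_FunD) simp
    have le: "wt (Fun h [?u]) \<le> w0" using Cons.prems by simp
    then have "wt (Fun h [?u]) \<le> wt ?u" using weight_ge_w0[OF u] by linarith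
    note h = weight_le_arg_imp_collapsing[OF t _ this]
    have "wt ?u \<le> w0" using h le by simp
    then show ?case using Cons.IH[OF u] Cons.prems(3) h terms_FunD(1)[OF t] by auto
  qed simp
  then show "g \<in> F" "ar g = 1" "w g = 0" "c g 0 = 1" by auto
qed

lemma length_arrange: "f \<in> F \<Longrightarrow> length (arrange \<sigma> f ss) = ar f"
  using status unfolding is_status_def arrange_def
  by (metis card_lessThan distinct_card length_map)

lemma nth_arrange_mem:
  assumes "Fun f ss \<in> terms F ar" "i < length (arrange \<sigma> f ss)"
  shows "arrange \<sigma> f ss ! i \<in> set ss"
proof -
  have "\<sigma> f ! i \<in> set (\<sigma> f)" using assms(2) by (simp add: arrange_def)
  then have "\<sigma> f ! i < length ss"
    using status terms_FunD(1,2)[OF assms(1)] by (auto simp: is_status_def)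
  then show ?thesis using assms(2) by (simp add: arrange_def)
qed

lemma arrange_unary:
  assumes "Fun f [s] \<in> terms F ar"
  shows "arrange \<sigma> f [s] = [s]"
proof -
  have "length (arrange \<sigma> f [s]) = 1"
    using length_arrange terms_FunD(1,2)[OF assms] by force
  moreover from this have "arrange \<sigma> f [s] ! 0 = s"
    using nth_arrange_mem[OF assms, of 0] by simp
  ultimately show ?thesis by (auto simp: length_Suc_conv)
qed

section \<open>The two inclusions between the orders\<close>

lemma wpo_pol_arg: "Fun f ss \<in> terms F ar \<Longrightarrow> s \<in> set ss \<Longrightarrow> wpo_pol (Fun f ss) s"
  by (rule wpo_argI) (auto intro: alg_geq_arg dest: terms_FunD(3))

text \<open>A fragment of transitivity that suffices here. The algebra clause uses weak simplicity;
  the argument clause uses induction, or \<open>wpo_pol_arg\<close> if the argument is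
  \<open>t\<close> itself; the function clause has the claim as a premise.\<close>

lemma wpo_pol_arg_right:
  "wpo_pol s t \<Longrightarrow> t = Fun g ts \<Longrightarrow> t' \<in> set ts \<Longrightarrow> wpo_pol s t'"
proof (induction rule: wpo.induct)
  case (alg s f ss t)
  then have "alg_gt A s t'"
    using alg_geq_arg[of g ts t'] unfolding alg_geq_A_pol_iff alg_gt_A_pol_iff
    by (meson le_less_trans order_trans)
  moreover have "t' \<in> terms F ar" using alg(3) alg.prems by (simp add: terms_FunD(3))
  ultimately show ?case by (intro wpo.alg[OF alg(1,2)])
next
  case (arg s f ss t)
  have t': "t' \<in> terms F ar" and tt': "alg_geq A t t'"
    using arg(3) arg.prems by (simp_all add: terms_FunD(3) alg_geq_arg)
  have "alg_geq A s t'" using arg(4) tt' unfolding alg_geq_A_pol_iff by (meson order_trans)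
  moreover have "wpo_pol t t'" using arg.prems arg(3) by (simp add: wpo_pol_arg)
  ultimately show ?case using arg t' by (intro wpo.arg[of s f ss]) auto
qed auto

text \<open>WPO has no clause for powers, so the unary symbols are peeled off one by one with the
  argument clause.\<close>

lemma wpo_pol_foldr:
  assumes "foldr (\<lambda>g u. Fun g [u]) fs (Var y) \<in> terms F ar" "fs \<noteq> []"
  shows "wpo_pol (foldr (\<lambda>g u. Fun g [u]) fs (Var y)) (Var y)"
  using assms
proof (induction fs)
  case (Cons h fs)
  let ?u = "foldr (\<lambda>g u. Fun g [u]) fs (Var y)"
  have t: "Fun h [?u] \<in> terms F ar" using Cons.prems by simp
  then have u: "?u \<in> terms F ar" by (rule terms_FunD) simp
  have uy: "wpo_pol ?u (Var y) \<or> ?u = Var y" using Cons.IH[OF u] by (cases "fs = []") auto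
  then have "alg_geq A ?u (Var y)"
    using wpo_A_pol_imp_alg_geq[of F ar w w0 c ge \<sigma> ?u "Var y"]
    by (elim disjE) (simp, simp only: alg_geq_A_pol_iff, simp)
  then have "alg_geq A (Fun h [?u]) (Var y)"
    using alg_geq_arg[OF t, of ?u] unfolding alg_geq_A_pol_iff
    by (simp del: weight.simps vc.simps) (meson order_trans)
  then show ?case using wpo_argI[OF t _ _ _ uy] by (simp add: terms.intros)
qed simp

text \<open>The work lies in the function clause, where WPO additionally demands that
  \<open>s\<close> is greater than every argument of \<open>t\<close>.\<close>

lemma tkbo_imp_wpo: "tkbo_m s t \<Longrightarrow> wpo_pol s t"
proof (induction rule: tkbo_gen.induct)
  case (weight s f ss t)
  then show ?case by (auto intro: wpo.alg simp: alg_gt_A_pol_iff simp del: weight.simps vc.simps)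
next
  case (var s f ss t y)
  then show ?case using wpo_pol_foldr unfolding fun_power_mod_def by metis
next
  case (func s f ss t g ts)
  have s: "Fun f ss \<in> terms F ar" and t: "Fun g ts \<in> terms F ar" using func by auto
  have st: "alg_geq A s t" using func by (simp add: alg_geq_A_pol_iff del: weight.simps vc.simps)
  have "wpo_pol s t'" if t': "t' \<in> set ts" for t'
  proof -
    have t't: "t' \<in> terms F ar" using terms_FunD(3)[OF t t'] .
    have st': "alg_geq A s t'"
      using st alg_geq_arg[OF t t'] func(6) unfolding alg_geq_A_pol_iff by (meson order_trans)
    show ?thesis
    proof (cases "wt s > wt t'")
      case True
      then have "alg_gt A s t'" using st' by (simp add: alg_geq_A_pol_iff alg_gt_A_pol_iff)
      then show ?thesis using func t't by (auto intro: wpo.alg)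
    next
      case False
      \<comment> \<open>Here \<open>t'\<close> carries the whole weight of \<open>t\<close>, so
        \<open>g\<close> is collapsing and greatest. This rules out that \<open>f\<close> is
        strictly above \<open>g\<close> and leaves a lexicographic comparison with
        \<open>[t']\<close>.\<close>
      then have "wt (Fun g ts) \<le> wt t'" using func(5,6) by simp
      note g = weight_le_arg_imp_collapsing[OF t t' this]
      have "ge g f"
        using collapsing_greatest g terms_FunD(1)[OF s] terms_FunD(1)[OF t] by blast
      then have "lex_gt (\<lambda>s t. tkbo_m s t \<and> wpo_pol s t) (arrange \<sigma> f ss) [t']"
        using func(7) g(1) t by (auto simp: strict_part_def arrange_unary)
      \<comment> \<open>The witness is the first arranged argument of \<open>s\<close>: strictly
        above \<open>t'\<close> if \<open>k = 0\<close>, above or equal if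
        \<open>k = 1\<close>.\<close>
      then obtain s' where "s' \<in> set ss" "wpo_pol s' t' \<or> s' = t'"
        using nth_arrange_mem[OF s, of 0] unfolding lex_gt_def
        by (fastforce simp: less_Suc_eq le_Suc_eq)
      then show ?thesis using wpo_argI[OF s t't] st' func(1) by blast
    qed
  qed
  then show ?case using func st
    by (intro wpo.func[of s f ss F ar t A g ts]) (auto simp: lex_gt_def)
qed

text \<open>The argument clause has no counterpart in TKBO. At equal weights it forces
  \<open>f\<close> to be collapsing, hence greatest, and then the variable or the function clause of
  TKBO applies.\<close>

lemma wpo_arg_imp_tkbo:
  assumes IH: "\<And>s' t. s' \<in> set ss \<Longrightarrow> wpo_pol s' t \<Longrightarrow> tkbo_m s' t"
    and s: "Fun f ss \<in> terms F ar" and t: "t \<in> terms F ar"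
    and st: "alg_geq A (Fun f ss) t"
    and s': "s' \<in> set ss" "wpo_pol s' t \<or> s' = t"
  shows "tkbo_m (Fun f ss) t"
proof (cases "wt (Fun f ss) > wt t")
  case True
  then show ?thesis using tkbo_gen.weight[OF refl s t] st unfolding alg_geq_A_pol_iff by blast
next
  case False
  have vcs: "\<forall>x. vc c x (Fun f ss) \<ge> vc c x t" and eq: "wt (Fun f ss) = wt t"
    using st False by (simp_all add: alg_geq_A_pol_iff del: weight.simps vc.simps)
  have "wt s' \<ge> wt t" using s'(2) by (auto dest!: wpo_A_pol_imp_alg_geq simp: alg_geq_A_pol_iff)
  then have "wt (Fun f ss) \<le> wt s'" using eq by simp
  note f = weight_le_arg_imp_collapsing[OF s s'(1) this]
  have fF: "f \<in> F" using s by (rule terms_FunD)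
  have top: "ge f g" if "g \<in> F" for g using collapsing_greatest f fF that by blast
  have wts': "wt s' = wt t" using eq f by simp
  show ?thesis
  proof (cases t)
    case (Var y)
    have "\<exists>fs. s' = foldr (\<lambda>g u. Fun g [u]) fs (Var y)"
    proof (cases "s' = t")
      case True
      then show ?thesis using Var by (intro exI[of _ "[]"]) simp
    next
      case False
      then have "tkbo_m s' (Var y)" using IH s' Var by blast
      \<comment> \<open>At equal weights and with a variable on the right, only the variable clause
        can apply.\<close>
      then show ?thesis using wts' Var
        by cases (auto simp: fun_power_mod_def simp del: weight.simps)
    qed
    then obtain fs where fs: "s' = foldr (\<lambda>g u. Fun g [u]) fs (Var y)" by blast
    have s't: "s' \<in> terms F ar" using terms_FunD(3)[OF s s'(1)] .
    \<comment> \<open>Every symbol of the chain is collapsing, hence greatest, and greatest symbols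
      are equivalent. They need not be equal, which is why powers are taken modulo
      equivalence.\<close>
    have "equiv_part ge f g" if "g \<in> set (f # fs)" for g
    proof -
      have "g \<in> F" "ar g = 1" "w g = 0"
        using that foldr_collapsing[OF s't[unfolded fs]] wts' Var fs f fF by auto
      then show ?thesis using top collapsing_greatest fF by (auto simp: equiv_part_def)
    qed
    then have "fun_power_mod ge f (Fun f ss) y"
      unfolding fun_power_mod_def using f fs by (intro exI[of _ "f # fs"]) auto
    then show ?thesis using tkbo_gen.var[OF refl s t vcs eq Var] by blast
  next
    case (Fun g ts)
    have tt: "Fun g ts \<in> terms F ar" using t Fun by simp
    then have gF: "g \<in> F" by (rule terms_FunD)
    have "lex_gt tkbo_m (arrange \<sigma> f ss) (arrange \<sigma> g ts)"
    proof (cases "arrange \<sigma> g ts = []")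
      case True
      \<comment> \<open>The nonempty list \<open>[s']\<close> beats the empty one with
        \<open>k = 0\<close>.\<close>
      then show ?thesis using f(1) s by (auto simp: lex_gt_def arrange_unary)
    next
      case False
      let ?t' = "arrange \<sigma> g ts ! 0"
      have t': "?t' \<in> set ts" using nth_arrange_mem[OF tt] False by simp
      have "wpo_pol t ?t'" using wpo_pol_arg[OF tt t'] Fun by simp
      \<comment> \<open>Since \<open>s'\<close> is above or equal to \<open>t\<close>, it is
        strictly above the first arranged argument of \<open>t\<close>, so the first components
        decide.\<close>
      then have "wpo_pol s' ?t'" using s'(2) wpo_pol_arg_right[OF _ Fun t'] by blast
      then have "tkbo_m s' ?t'" using IH s' by blast
      then show ?thesis using f(1) s False by (auto simp: lex_gt_def arrange_unary)
    qed
    moreover have "strict_part ge f g \<or> equiv_part ge f g"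
      using top[OF gF] by (auto simp: strict_part_def equiv_part_def)
    ultimately show ?thesis using tkbo_gen.func[OF refl s t vcs eq Fun] by blast
  qed
qed

text \<open>Structural induction on \<open>s\<close> with \<open>t\<close> arbitrary, because
  \<open>wpo_arg_imp_tkbo\<close> compares an argument of \<open>s\<close> also with arguments of
  \<open>t\<close>; induction on the derivation would not cover those pairs.\<close>

lemma wpo_imp_tkbo: "wpo_pol s t \<Longrightarrow> tkbo_m s t"
proof (induction s arbitrary: t)
  case (Var x)
  then show ?case by (auto elim: wpo.cases)
next
  case (Fun f ss)
  from Fun.prems show ?case
  proof cases
    case (alg f' ss')
    then show ?thesis using tkbo_gen.weight[OF refl alg(2,3)] unfolding alg_gt_A_pol_iff by blast
  next
    case (arg f' ss')
    then show ?thesis using Fun.IH by (auto intro: wpo_arg_imp_tkbo)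
  next
    case (func f' ss' g ts)
    have vcs: "\<forall>x. vc c x (Fun f ss) \<ge> vc c x t" and ge: "wt (Fun f ss) \<ge> wt t"
      using func by (simp_all add: alg_geq_A_pol_iff del: weight.simps vc.simps)
    show ?thesis
    proof (cases "wt (Fun f ss) > wt t")
      case True
      then show ?thesis using tkbo_gen.weight[OF refl func(2,3) vcs] by blast
    next
      case False
      then have eq: "wt (Fun f ss) = wt t" using ge by simp
      have "lex_gt tkbo_m (arrange \<sigma> f ss) (arrange \<sigma> g ts)"
        if "lex_gt wpo_pol (arrange \<sigma> f ss) (arrange \<sigma> g ts)"
        using that
      \<comment> \<open>The induction hypothesis covers only arguments of \<open>s\<close> on the
        left, so monotonicity is needed relative to the entries of the left list.\<close>
      proof (rule lex_gt_mono_on_set)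
        fix u v assume "u \<in> set (arrange \<sigma> f ss)" and uv: "wpo_pol u v"
        then have "u \<in> set ss" using nth_arrange_mem[OF func(2)] by (metis in_set_conv_nth)
        then show "tkbo_m u v" using uv by (rule Fun.IH)
      qed
      then show ?thesis
        using func by (intro tkbo_gen.func[OF refl func(2,3) vcs eq func(5)]) auto
    qed
  qed
qed

section \<open>Agreement with literal powers\<close>

lemma tkbo_mod_eq_tkbo:
  assumes unique: "\<And>f g. f \<in> F \<Longrightarrow> g \<in> F \<Longrightarrow> ar f = 1 \<Longrightarrow> w f = 0 \<Longrightarrow> c f 0 = 1 \<Longrightarrow>
      ar g = 1 \<Longrightarrow> w g = 0 \<Longrightarrow> c g 0 = 1 \<Longrightarrow> f = g"
  shows "tkbo_m = tkbo F ar w w0 c ge \<sigma>"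
proof -
  have pow: "foldr (\<lambda>g u. Fun g [u]) (replicate k f) t = ((\<lambda>u. Fun f [u]) ^^ k) t"
    for k and f :: 'f and t :: "('f, 'v) trm"
    by (induction k) auto
  have to_power: "fun_power f (Fun f ss) y"
    if s: "Fun f ss \<in> terms F ar" "wt (Fun f ss) = w0" "fun_power_mod ge f (Fun f ss) y"
    for f ss and y :: 'v
  proof -
    obtain fs where fs: "fs \<noteq> []" "Fun f ss = foldr (\<lambda>g u. Fun g [u]) fs (Var y)"
      using s(3) by (auto simp: fun_power_mod_def)
    \<comment> \<open>As the chain weighs no more than a variable, all its symbols, among them the
      head \<open>f\<close>, are collapsing; uniqueness makes them all equal to
      \<open>f\<close>.\<close>
    note col = foldr_collapsing[of fs y, folded fs(2), OF s(1) eq_refl[OF s(2)]]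
    have "f \<in> set fs" using fs by (cases fs) auto
    then have "\<forall>g\<in>set fs. g = f" using unique col by metis
    then have "fs = replicate (length fs) f" by (simp add: replicate_length_same)
    then show ?thesis using fs pow[of "length fs" f "Var y"]
      by (auto simp: fun_power_def intro!: exI[of _ "length fs"])
  qed
  have from_power: "fun_power_mod ge f (Fun f ss) y"
    if s: "Fun f ss \<in> terms F ar" "fun_power f (Fun f ss) y" for f ss and y :: 'v
  proof -
    obtain k where k: "k > 0" "Fun f ss = foldr (\<lambda>g u. Fun g [u]) (replicate k f) (Var y)"
      using s(2) by (auto simp: fun_power_def pow)
    have "equiv_part ge f f"
      using precedence terms_FunD(1)[OF s(1)]
      by (auto simp: quasi_precedence_def equiv_part_def dest: reflp_onD)
    then show ?thesis unfolding fun_power_mod_def using k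
      by (intro exI[of _ "replicate k f"]) auto
  qed
  show ?thesis
  proof (intro ext iffI)
    fix s t :: "('f, 'v) trm"
    show "tkbo F ar w w0 c ge \<sigma> s t" if "tkbo_m s t"
      using to_power that by (rule tkbo_gen_mono)
    show "tkbo_m s t" if "tkbo F ar w w0 c ge \<sigma> s t"
      using from_power that by (rule tkbo_gen_mono)
  qed
qed

end

text \<open>The two conjuncts treat the two readings of the power in the variable clause. The
  uniqueness condition for literal powers is exact: two distinct such symbols separate the orders by
  \<open>wpo_neq_tkbo\<close>.\<close>

theorem theorem18:
  fixes F :: "'f set" and ar :: "'f \<Rightarrow> nat"
    and w :: "'f \<Rightarrow> nat" and w0 :: nat and c :: "'f \<Rightarrow> nat \<Rightarrow> nat"
    and ge :: "'f \<Rightarrow> 'f \<Rightarrow> bool" and \<sigma> :: "'f \<Rightarrow> nat list"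
  assumes "finite F"
    and "weight_function F ar w w0"
    and "subterm_coefficient F ar c"
    and "quasi_precedence F ge"
    and "is_status F ar \<sigma>"
    and "w0 > 0"
    and "admissible F ar w ge"
  shows "(wpo F ar (A_pol w w0 c) ge \<sigma> :: ('f, 'v) trm \<Rightarrow> ('f, 'v) trm \<Rightarrow> bool) =
           tkbo_mod F ar w w0 c ge \<sigma> \<and>
         ((\<forall>f\<in>F. \<forall>g\<in>F. ar f = 1 \<and> w f = 0 \<and> c f 0 = 1 \<and> ar g = 1 \<and> w g = 0 \<and> c g 0 = 1
             \<longrightarrow> f = g) \<longrightarrow>
          (wpo F ar (A_pol w w0 c) ge \<sigma> :: ('f, 'v) trm \<Rightarrow> ('f, 'v) trm \<Rightarrow> bool) =
            tkbo F ar w w0 c ge \<sigma>)"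
proof -
  interpret weighted_precedence F ar w w0 c ge \<sigma>
    using assms(2-) by unfold_locales
  have "(wpo_pol :: ('f, 'v) trm \<Rightarrow> ('f, 'v) trm \<Rightarrow> bool) = tkbo_m"
    using wpo_imp_tkbo tkbo_imp_wpo by blast
  then show ?thesis using tkbo_mod_eq_tkbo by metis
qed

end
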